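(* Let $n\ge 2$ and let $x\in\{0,1,\ldots,2^{n-1}-1\}$. Then the generalized Toffoli gate $T^{(n)}_x$ represents the adjacent transposition $(2x,2x+1)$ of the set $\{0,1,\ldots,2^n-1\}$; that is, $T^{(n)}_x|2x\rangle_n=|2x+1\rangle_n$, $T^{(n)}_x|2x+1\rangle_n=|2x\rangle_n$, and $T^{(n)}_x|q\rangle_n=|q\rangle_n$ for every other $q\in\{0,\ldots,2^n-1\}$.
   Context: The canonical basis of $\mathbb{C}^{2^n}=(\mathbb{C}^2)^{\otimes n}$ is $\{|q\rangle_n=|q_{n-1}\cdots q_1q_0\rangle_n : q_j\in\{0,1\}\}$, where $q=\sum_{j=0}^{n-1}q_j2^j\in\{0,\ldots,2^n-1\}$. $X$ is the Pauli (NOT) matrix, $X|0\rangle=|1\rangle$, $X|1\rangle=|0\rangle$. For $x\in\{0,\ldots,2^{n-1}-1\}$ with $(n-1)$-bit binary representation $(x_{n-2},\ldots,x_0)$, $x=\sum_{j=0}^{n-2}x_j2^j$, the (generalized) Toffoli gate $T^{(n)}_x:\mathbb{C}^{2^n}\to\mathbb{C}^{2^n}$ is the linear map with $T^{(n)}_x|q_{n-1}\cdots q_1q_0\rangle_n=|q_{n-1}\cdots q_1\rangle_{n-1}\otimes(X|q_0\rangle_1)$ if $(x_{n-2},\ldots,x_0)=(q_{n-1},\ldots,q_1)$, and $T^{(n)}_x|q_{n-1}\cdots q_0\rangle_n=|q_{n-1}\cdots q_0\rangle_n$ otherwise. *)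

theory Defs
  imports "Jordan_Normal_Form.Matrix" "HOL-Combinatorics.Permutations"
begin

(* The tensor product on coordinate vectors, C^m (x) C^k = C^(m*k), with the left factor most
   significant: e_i (x) e_j = e_(i*k + j). *)
definition tensor_vec :: "complex vec \<Rightarrow> complex vec \<Rightarrow> complex vec" where
  "tensor_vec u v =
     vec (dim_vec u * dim_vec v) (\<lambda>i. u $ (i div dim_vec v) * v $ (i mod dim_vec v))"

(* |0> and |1>; the bit 1 is True. *)
definition qubit :: "bool \<Rightarrow> complex vec" where
  "qubit c = unit_vec 2 (of_bool c)"

(* qubits n b = |b_(n-1) ... b_1 b_0>_n; only the values of b below n matter. *)
fun qubits :: "nat \<Rightarrow> (nat \<Rightarrow> bool) \<Rightarrow> complex vec" where
  "qubits 0 b = unit_vec 1 0"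
| "qubits (Suc n) b = tensor_vec (qubit (b n)) (qubits n b)"

(* ket n q = |q>_n for q < 2^n, where q = sum q_j 2^j. *)
definition ket :: "nat \<Rightarrow> nat \<Rightarrow> complex vec" where
  "ket n q = qubits n (bit q)"

definition pauli_X :: "complex mat" where
  "pauli_X = mat_of_rows_list 2 [[0, 1], [1, 0]]"

(* Linear maps on C^(2^n) are given by their matrices in the standard basis. The bit function b
   ranges over all basis states |b_(n-1) ... b_0>_n. *)
definition is_toffoli :: "nat \<Rightarrow> nat \<Rightarrow> complex mat \<Rightarrow> bool" where
  "is_toffoli n x T \<longleftrightarrow>
     T \<in> carrier_mat (2 ^ n) (2 ^ n) \<and>
     (\<forall>b. T *\<^sub>v qubits n b =
        (if \<forall>j < n - 1. bit x j = b (Suc j)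
         then tensor_vec (qubits (n - 1) (\<lambda>j. b (Suc j))) (pauli_X *\<^sub>v qubit (b 0))
         else qubits n b))"

(* Unique existence is is_toffoli_ex1 below. *)
definition toffoli :: "nat \<Rightarrow> nat \<Rightarrow> complex mat" where
  "toffoli n x = (THE T. is_toffoli n x T)"

definition represents_perm :: "nat \<Rightarrow> complex mat \<Rightarrow> (nat \<Rightarrow> nat) \<Rightarrow> bool" where
  "represents_perm n A \<sigma> \<longleftrightarrow>
     A \<in> carrier_mat (2 ^ n) (2 ^ n) \<and> \<sigma> permutes {0..<2 ^ n} \<and>
     (\<forall>q < 2 ^ n. A *\<^sub>v ket n q = ket n (\<sigma> q))"

lemma tensor_unit_vec:
  assumes "i < m" "j < k"
  shows "tensor_vec (unit_vec m i) (unit_vec k j) = unit_vec (m * k) (i * k + j)"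
proof (rule eq_vecI)
  fix l assume "l < dim_vec (unit_vec (m * k) (i * k + j) :: complex vec)"
  then have l: "l < m * k" by simp
  have "0 < k" using assms by simp
  have d: "l div k < m" using l by (simp add: less_mult_imp_div_less)
  have ij: "i * k + j < m * k"
  proof -
    have "i * k + j < Suc i * k" using assms(2) by simp
    also have "\<dots> \<le> m * k" using assms(1) by (intro mult_right_mono) auto
    finally show ?thesis .
  qed
  have iff: "l = i * k + j \<longleftrightarrow> l div k = i \<and> l mod k = j"
    using assms(2) by (auto simp: div_mult_mod_eq)
  show "tensor_vec (unit_vec m i) (unit_vec k j) $ l = unit_vec (m * k) (i * k + j) $ l"
    using l d ij \<open>0 < k\<close> assms iff by (auto simp: tensor_vec_def)
qed (simp add: tensor_vec_def)

abbreviation bits_val :: "nat \<Rightarrow> (nat \<Rightarrow> bool) \<Rightarrow> nat" where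
  "bits_val n b \<equiv> (\<Sum>j<n. of_bool (b j) * 2 ^ j)"

lemma bits_val_less: "bits_val n b < 2 ^ n"
  by (induction n) (auto simp: of_bool_def)

lemma qubits_eq_unit_vec: "qubits n b = unit_vec (2 ^ n) (bits_val n b)"
proof (induction n)
  case (Suc n)
  have "of_bool (b n) < (2 :: nat)" by simp
  from tensor_unit_vec[OF this bits_val_less[where n = n and b = b]]
  show ?case using Suc by (simp add: qubit_def add.commute)
qed simp

lemma bits_val_horner: "bits_val n b = horner_sum of_bool 2 (map b [0..<n])"
  by (simp add: horner_sum_eq_sum atLeast0LessThan)

lemma bits_val_bit: "q < 2 ^ n \<Longrightarrow> bits_val n (bit q) = q"
  by (simp only: bits_val_horner horner_sum_bit_eq_take_bit take_bit_nat_eq_self)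

lemma bit_bits_val: "j < n \<Longrightarrow> bit (bits_val n b) j = b j"
  by (simp only: bits_val_horner bit_horner_sum_bit_iff) simp

lemma ket_eq_unit_vec: "q < 2 ^ n \<Longrightarrow> ket n q = unit_vec (2 ^ n) q"
  by (simp only: ket_def qubits_eq_unit_vec bits_val_bit)

lemma qubits_cong: "(\<And>j. j < n \<Longrightarrow> b j = c j) \<Longrightarrow> qubits n b = qubits n c"
  by (simp add: qubits_eq_unit_vec)

lemma is_toffoli_ex1:
  assumes "0 < n"
  shows "\<exists>!T. is_toffoli n x T"
proof -
  define R where "R b = (if \<forall>j < n - 1. bit x j = b (Suc j)
         then tensor_vec (qubits (n - 1) (\<lambda>j. b (Suc j))) (pauli_X *\<^sub>v qubit (b 0))
         else qubits n b)" for b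
  have dim: "dim_vec (R b) = 2 ^ n" for b
    using assms by (cases n)
      (auto simp: R_def qubits_eq_unit_vec tensor_vec_def pauli_X_def mat_of_rows_list_def)
  have cong: "R b = R c" if "\<And>j. j < n \<Longrightarrow> b j = c j" for b c
  proof -
    have "qubits n b = qubits n c" using that by (rule qubits_cong)
    moreover have "qubits (n - 1) (\<lambda>j. b (Suc j)) = qubits (n - 1) (\<lambda>j. c (Suc j))"
      using that by (intro qubits_cong) auto
    ultimately show ?thesis using that assms by (auto simp: R_def)
  qed
  have iff: "is_toffoli n x T \<longleftrightarrow> T \<in> carrier_mat (2 ^ n) (2 ^ n) \<and>
      (\<forall>b. T *\<^sub>v unit_vec (2 ^ n) (bits_val n b) = R b)" for T
    by (simp only: is_toffoli_def R_def qubits_eq_unit_vec[symmetric])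
  have col: "T *\<^sub>v unit_vec (2 ^ n) i = col T i"
    if "T \<in> carrier_mat (2 ^ n) (2 ^ n)" "i < 2 ^ n" for T :: "complex mat" and i
    using that by (intro eq_vecI) auto
  define T where "T = mat (2 ^ n) (2 ^ n) (\<lambda>(i, j). R (bit j) $ i)"
  show ?thesis
  proof (rule ex1I[of _ T])
    show "is_toffoli n x T"
      unfolding iff
    proof (intro conjI allI)
      show T: "T \<in> carrier_mat (2 ^ n) (2 ^ n)" by (simp add: T_def)
      fix b
      have "T *\<^sub>v unit_vec (2 ^ n) (bits_val n b) = col T (bits_val n b)"
        using T bits_val_less by (rule col)
      also have "\<dots> = R (bit (bits_val n b))"
        using bits_val_less[where n = n and b = b] by (intro eq_vecI) (auto simp: T_def dim)
      also have "\<dots> = R b" by (intro cong bit_bits_val)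
      finally show "T *\<^sub>v unit_vec (2 ^ n) (bits_val n b) = R b" .
    qed
  next
    fix S assume S: "is_toffoli n x S"
    have c: "col S i = R (bit i)" if "i < 2 ^ n" for i
      using S that col[of S i] unfolding iff by (metis bits_val_bit)
    show "S = T"
    proof (rule eq_matI)
      fix i j assume ij: "i < dim_row T" "j < dim_col T"
      then have "S $$ (i, j) = col S j $ i" using S unfolding iff by (auto simp: T_def)
      then show "S $$ (i, j) = T $$ (i, j)" using ij c[of j] by (auto simp: T_def)
    qed (use S in \<open>auto simp: iff T_def\<close>)
  qed
qed

lemma is_toffoli_toffoli: "0 < n \<Longrightarrow> is_toffoli n x (toffoli n x)"
  unfolding toffoli_def using is_toffoli_ex1 by (rule theI')

end

theory Submission
  imports Defs
begin

text \<open>Deleting the last binary digit of q halves it, so the control bits of |q> spell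
  \<open>q div 2\<close>. The gate therefore acts exactly when \<open>q div 2 = x\<close>
  (\<open>bits_eq_div_2_iff\<close>), that is, for q = 2x and q = 2x + 1. These two differ only in
  the last bit, which X flips, so they are exchanged and all other basis vectors stay fixed
  (\<open>toffoli_ket\<close>).\<close>

lemma pauli_X_qubit: "pauli_X *\<^sub>v qubit c = qubit (\<not> c)"
  by (rule eq_vecI)
    (auto simp: pauli_X_def mat_of_rows_list_def qubit_def scalar_prod_def less_Suc_eq
      sum.atLeast0_lessThan_Suc numeral_2_eq_2)

text \<open>Bit j + 1 of q is bit j of \<open>q div 2\<close>, and a number below 2 ^ m is
  determined by its m lowest bits.\<close>

lemma bits_eq_div_2_iff:
  fixes x q :: nat
  assumes "x < 2 ^ m" "q < 2 ^ Suc m"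
  shows "(\<forall>j<m. bit x j = bit q (Suc j)) \<longleftrightarrow> x = q div 2"
proof
  assume "\<forall>j<m. bit x j = bit q (Suc j)"
  then have "bits_val m (bit x) = bits_val m (bit (q div 2))"
    by (intro sum.cong) (auto simp: bit_Suc)
  moreover have "q div 2 < 2 ^ m" using assms(2) by auto
  ultimately show "x = q div 2" using assms(1) by (simp only: bits_val_bit)
qed (auto simp: bit_Suc)

lemma toffoli_ket:
  assumes "0 < n" "x < 2 ^ (n - 1)" "q < 2 ^ n"
  shows "toffoli n x *\<^sub>v ket n q = ket n (Transposition.transpose (2 * x) (2 * x + 1) q)"
proof -
  obtain m where n: "n = Suc m" using assms(1) by (cases n) auto
  have "is_toffoli n x (toffoli n x)" using assms(1) by (rule is_toffoli_toffoli)
  \<comment> \<open>The defining condition of the gate at the bit function \<open>bit q\<close>. Bit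
    0 of q is \<open>odd q\<close>, so the flipped target is \<open>even q\<close>.\<close>
  then have T: "toffoli n x *\<^sub>v ket n q =
      (if x = q div 2 then tensor_vec (ket m (q div 2)) (qubit (even q)) else ket n q)"
    using bits_eq_div_2_iff[of x m q] assms
    by (simp add: is_toffoli_def ket_def n pauli_X_qubit bit_Suc bit_0 del: qubits.simps)
  show ?thesis
  proof (cases "x = q div 2")
    case True
    \<comment> \<open>This is q with its last bit flipped, as q = 2x + q mod 2 here.\<close>
    let ?r = "2 * x + of_bool (even q)"
    have r: "?r < 2 ^ n" using assms(2) by (auto simp: n)
    have "tensor_vec (ket m x) (qubit (even q)) = unit_vec (2 ^ m * 2) (x * 2 + of_bool (even q))"
      using assms(2) by (simp add: n ket_eq_unit_vec qubit_def tensor_unit_vec)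
    also have "\<dots> = ket n ?r" using r by (simp add: ket_eq_unit_vec n mult.commute)
    also have "?r = Transposition.transpose (2 * x) (2 * x + 1) q"
      using True by (cases "even q") (auto simp: Transposition.transpose_def elim!: evenE oddE)
    finally show ?thesis using T True by simp
  next
    case False
    then have "q \<noteq> 2 * x" "q \<noteq> 2 * x + 1" by auto
    then show ?thesis using T False by simp
  qed
qed

theorem theorem3p1:
  fixes n x :: nat
  assumes "n \<ge> 2" and "x < 2 ^ (n - 1)"
  shows "represents_perm n (toffoli n x) (Transposition.transpose (2 * x) (2 * x + 1)) \<and>
    toffoli n x *\<^sub>v ket n (2 * x) = ket n (2 * x + 1) \<and>
    toffoli n x *\<^sub>v ket n (2 * x + 1) = ket n (2 * x) \<and>
    (\<forall>q < 2 ^ n. q \<noteq> 2 * x \<and> q \<noteq> 2 * x + 1 \<longrightarrow> toffoli n x *\<^sub>v ket n q = ket n q)"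
proof -
  have n: "0 < n" using assms(1) by simp
  \<comment> \<open>From x + 1 \<le> 2 ^ (n - 1), doubling keeps even 2x + 1 below 2 ^ n, so both
    swapped points are valid indices.\<close>
  have "(2 :: nat) ^ n = 2 * 2 ^ (n - 1)" using n by (simp add: power_eq_if)
  then have less: "2 * x < 2 ^ n" "2 * x + 1 < 2 ^ n" using assms(2) by linarith+
  have "toffoli n x \<in> carrier_mat (2 ^ n) (2 ^ n)"
    using is_toffoli_toffoli[OF n] by (simp add: is_toffoli_def)
  moreover have "Transposition.transpose (2 * x) (2 * x + 1) permutes {0..<2 ^ n}"
    using less by (intro permutes_swap_id) auto
  moreover note toffoli_ket[OF n assms(2)]
  ultimately show ?thesis using less by (simp add: represents_perm_def)
qed

end
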